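(* Let $\mathcal{F}_1,\mathcal{F}_2,\mathcal{F}_3$ be free linkages in the plane. Then the space $M(\mathcal{F}_1,\mathcal{F}_2,\mathcal{F}_3)$ is homeomorphic to the fibered product $M(\mathcal{F}_1,\mathcal{F}_2)\times_{M(\mathcal{F}_1)}M(\mathcal{F}_1,\mathcal{F}_3)$.
   Context: A free linkage $\mathcal{F}$ in $\mathbb{R}^2$ with length vector $(d_1,\ldots,d_n)$, $d_i>0$, has configurations $(x_1,\ldots,x_{n+1})\in(\mathbb{R}^2)^{n+1}$ with $|x_i-x_{i+1}|=d_i$ for $i=1,\ldots,n$; $x_1$ is the initial and $x_{n+1}$ the terminal vertex. For free linkages $\mathcal{F}_1,\ldots,\mathcal{F}_r$ ($r\ge 1$), $C(\mathcal{F}_1,\ldots,\mathcal{F}_r)$ is the space of $r$-tuples of configurations of $\mathcal{F}_1,\ldots,\mathcal{F}_r$ with all initial vertices at the origin and all terminal vertices coinciding, and $M(\mathcal{F}_1,\ldots,\mathcal{F}_r)=C(\mathcal{F}_1,\ldots,\mathcal{F}_r)/SO(2)$; it is identified with the set of tuples in which the first edge of $\mathcal{F}_1$ lies on the positive $x$-axis. For maps $q_1:Y_1\to Z$ and $q_2:Y_2\to Z$, the fibered product is $Y_1\times_Z Y_2=\{(y_1,y_2)\in Y_1\times Y_2 : q_1(y_1)=q_2(y_2)\}$. Here $q_1:M(\mathcal{F}_1,\mathcal{F}_2)\to M(\mathcal{F}_1)$ and $q_2:M(\mathcal{F}_1,\mathcal{F}_3)\to M(\mathcal{F}_1)$ are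 the maps that forget $\mathcal{F}_2$, respectively $\mathcal{F}_3$, and keep the configuration of $\mathcal{F}_1$. Moduli spaces may be empty, with $\emptyset\times_Z X=\emptyset$. *)

theory Defs
  imports "HOL-Analysis.Analysis"
begin

text \<open>A free linkage is given by its list of edge lengths.  With \<open>n = length d\<close> edges, the
  vertices are indexed by \<open>{0..n}\<close>: the initial vertex is \<open>x 0\<close>, the terminal one \<open>x n\<close>.\<close>

definition free_linkage :: "real list \<Rightarrow> bool" where
  "free_linkage d \<longleftrightarrow> d \<noteq> [] \<and> (\<forall>l \<in> set d. 0 < l)"

definition chain_configs :: "real list \<Rightarrow> (nat \<Rightarrow> real^2) set" where
  "chain_configs d =
     {x \<in> extensional {0..length d}. \<forall>i < length d. dist (x i) (x (Suc i)) = d ! i}"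

definition joint_configs :: "real list list \<Rightarrow> (nat \<Rightarrow> nat \<Rightarrow> real^2) set" where
  "joint_configs Fs =
     {c \<in> \<Pi>\<^sub>E j\<in>{..<length Fs}. chain_configs (Fs ! j).
        (\<forall>j < length Fs. c j 0 = 0) \<and>
        (\<forall>j < length Fs. \<forall>k < length Fs. c j (length (Fs ! j)) = c k (length (Fs ! k)))}"

definition config_space :: "real list list \<Rightarrow> (nat \<Rightarrow> nat \<Rightarrow> real^2) topology" where
  "config_space Fs =
     subtopology
       (product_topology (\<lambda>j. product_topology (\<lambda>i. euclidean) {0..length (Fs ! j)}) {..<length Fs})
       (joint_configs Fs)"

text \<open>The restrictions keep the rotated tuple extensional.\<close>

definition rotate_config ::
  "real list list \<Rightarrow> real^2^2 \<Rightarrow> (nat \<Rightarrow> nat \<Rightarrow> real^2) \<Rightarrow> (nat \<Rightarrow> nat \<Rightarrow> real^2)" where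
  "rotate_config Fs A c = (\<lambda>j\<in>{..<length Fs}. \<lambda>i\<in>{0..length (Fs ! j)}. A *v c j i)"

definition SO2_orbit ::
  "real list list \<Rightarrow> (nat \<Rightarrow> nat \<Rightarrow> real^2) \<Rightarrow> (nat \<Rightarrow> nat \<Rightarrow> real^2) set" where
  "SO2_orbit Fs c = {rotate_config Fs A c | A. rotation_matrix A}"

definition quotient_topology :: "'a topology \<Rightarrow> ('a \<Rightarrow> 'b) \<Rightarrow> 'b topology" where
  "quotient_topology X q =
     topology (\<lambda>U. U \<subseteq> q ` topspace X \<and> openin X {x \<in> topspace X. q x \<in> U})"

definition moduli_space :: "real list list \<Rightarrow> (nat \<Rightarrow> nat \<Rightarrow> real^2) set topology" where
  "moduli_space Fs = quotient_topology (config_space Fs) (SO2_orbit Fs)"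

text \<open>The map of moduli spaces that keeps only the configuration of the first linkage, acting on
  an orbit elementwise; by \<open>keep_first_SO2_orbit\<close> below the result is again an orbit.\<close>

definition keep_first :: "(nat \<Rightarrow> nat \<Rightarrow> real^2) set \<Rightarrow> (nat \<Rightarrow> nat \<Rightarrow> real^2) set" where
  "keep_first P = (\<lambda>c. restrict c {..<1}) ` P"

definition fibered_product ::
  "'a topology \<Rightarrow> ('a \<Rightarrow> 'c) \<Rightarrow> 'b topology \<Rightarrow> ('b \<Rightarrow> 'c) \<Rightarrow> ('a \<times> 'b) topology" where
  "fibered_product Y1 q1 Y2 q2 =
     subtopology (prod_topology Y1 Y2) {(y1, y2). q1 y1 = q2 y2}"

lemma openin_quotient_topology:
  "openin (quotient_topology X q) U \<longleftrightarrow>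
     U \<subseteq> q ` topspace X \<and> openin X {x \<in> topspace X. q x \<in> U}"
proof -
  have "istopology (\<lambda>U. U \<subseteq> q ` topspace X \<and> openin X {x \<in> topspace X. q x \<in> U})"
    unfolding istopology_def
  proof (intro conjI allI impI)
    fix S T
    assume S: "S \<subseteq> q ` topspace X \<and> openin X {x \<in> topspace X. q x \<in> S}"
      and T: "T \<subseteq> q ` topspace X \<and> openin X {x \<in> topspace X. q x \<in> T}"
    have "{x \<in> topspace X. q x \<in> S \<inter> T} =
        {x \<in> topspace X. q x \<in> S} \<inter> {x \<in> topspace X. q x \<in> T}"
      by auto
    then show "openin X {x \<in> topspace X. q x \<in> S \<inter> T}"
      using S T by (simp add: openin_Int)
    show "S \<inter> T \<subseteq> q ` topspace X"
      using S by auto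
  next
    fix K
    assume K: "\<forall>S\<in>K. S \<subseteq> q ` topspace X \<and> openin X {x \<in> topspace X. q x \<in> S}"
    have "{x \<in> topspace X. q x \<in> \<Union>K} = (\<Union>S\<in>K. {x \<in> topspace X. q x \<in> S})"
      by auto
    then show "openin X {x \<in> topspace X. q x \<in> \<Union>K}"
      using K by auto
    show "\<Union>K \<subseteq> q ` topspace X"
      using K by auto
  qed
  then show ?thesis
    by (simp add: quotient_topology_def)
qed

lemma topspace_quotient_topology [simp]: "topspace (quotient_topology X q) = q ` topspace X"
proof
  show "topspace (quotient_topology X q) \<subseteq> q ` topspace X"
    using openin_topspace[of "quotient_topology X q"] unfolding openin_quotient_topology by simp
  have "{x \<in> topspace X. q x \<in> q ` topspace X} = topspace X"
    by auto
  then have "openin (quotient_topology X q) (q ` topspace X)"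
    by (simp add: openin_quotient_topology)
  then show "q ` topspace X \<subseteq> topspace (quotient_topology X q)"
    by (rule openin_subset)
qed

lemma quotient_map_quotient_topology: "quotient_map X (quotient_topology X q) q"
  unfolding quotient_map_def openin_quotient_topology by simp

lemma topspace_config_space [simp]: "topspace (config_space Fs) = joint_configs Fs"
proof -
  have "joint_configs Fs \<subseteq> (\<Pi>\<^sub>E j\<in>{..<length Fs}. \<Pi>\<^sub>E i\<in>{0..length (Fs ! j)}. UNIV)"
    unfolding joint_configs_def chain_configs_def by (force simp: PiE_iff)
  then show ?thesis
    by (simp add: config_space_def Int_absorb1)
qed

lemma rotate_config_in_joint_configs:
  assumes A: "rotation_matrix A" and c: "c \<in> joint_configs Fs"
  shows "rotate_config Fs A c \<in> joint_configs Fs"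
proof -
  have "orthogonal_transformation ((*v) A)"
    using A by (simp add: rotation_matrix_def orthogonal_transformation_matrix)
  then have "dist (A *v x) (A *v y) = dist x y" for x y
    by (simp add: orthogonal_transformation_isometry)
  moreover have "c j \<in> chain_configs (Fs ! j)" "c j 0 = 0" if "j < length Fs" for j
    using c that by (auto simp: joint_configs_def PiE_iff)
  ultimately have "rotate_config Fs A c j \<in> chain_configs (Fs ! j)"
    "rotate_config Fs A c j 0 = 0" if "j < length Fs" for j
    using that by (auto simp: chain_configs_def rotate_config_def)
  moreover have "rotate_config Fs A c j (length (Fs ! j)) = rotate_config Fs A c k (length (Fs ! k))"
    if "j < length Fs" "k < length Fs" for j k
  proof -
    have "c j (length (Fs ! j)) = c k (length (Fs ! k))"
      using c that unfolding joint_configs_def by blast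
    then show ?thesis
      using that by (simp add: rotate_config_def)
  qed
  moreover have "rotate_config Fs A c \<in> extensional {..<length Fs}"
    by (simp add: rotate_config_def)
  ultimately show ?thesis
    unfolding joint_configs_def PiE_iff by blast
qed

lemma keep_first_SO2_orbit:
  assumes "Fs \<noteq> []"
  shows "keep_first (SO2_orbit Fs c) = SO2_orbit [hd Fs] (restrict c {..<1})"
proof -
  have "restrict (rotate_config Fs A c) {..<1} = rotate_config [hd Fs] A (restrict c {..<1})" for A
    using assms by (auto simp: rotate_config_def hd_conv_nth fun_eq_iff restrict_def)
  moreover have "keep_first (SO2_orbit Fs c) =
      {restrict (rotate_config Fs A c) {..<1} | A. rotation_matrix A}"
    unfolding keep_first_def SO2_orbit_def by blast
  ultimately show ?thesis
    by (simp add: SO2_orbit_def)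
qed

lemma keep_first_moduli_space:
  assumes "Fs \<noteq> []" and P: "P \<in> topspace (moduli_space Fs)"
  shows "keep_first P \<in> topspace (moduli_space [hd Fs])"
proof -
  obtain c where c: "c \<in> joint_configs Fs" "P = SO2_orbit Fs c"
    using P by (auto simp: moduli_space_def)
  then have "c 0 \<in> chain_configs (hd Fs)" "c 0 0 = 0"
    using assms by (auto simp: joint_configs_def PiE_iff hd_conv_nth)
  then have "restrict c {..<1} \<in> joint_configs [hd Fs]"
    by (simp add: joint_configs_def PiE_iff)
  then show ?thesis
    using c assms by (auto simp: moduli_space_def keep_first_SO2_orbit)
qed

end

theory Submission
  imports Defs
begin

text \<open>
  The rotation group acts freely on the joint configurations, because the first edge of the first
  linkage has positive length and hence points in some direction.  Rotating this direction to the
  positive \<open>x\<close>-axis picks out one representative of each orbit, and this representative depends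
  continuously on the orbit: it gives a continuous section of the orbit map
  (\<open>continuous_map_normal_form\<close>).

  Forgetting linkages commutes with rotations, so it descends to the moduli spaces and yields a
  continuous map from \<open>M(F1, F2, F3)\<close> to the fibered product.  For the inverse, let two orbits in
  \<open>M(F1, F2)\<close> and \<open>M(F1, F3)\<close> lie over the same orbit in \<open>M(F1)\<close>.  The configurations of \<open>F1\<close> in
  their normal forms differ by a rotation that preserves the positive \<open>x\<close>-axis, so they are
  \<^emph>\<open>equal\<close>, not merely congruent.  In particular all three terminal vertices coincide, the two
  normal forms can be glued along \<open>F1\<close>, and the orbit of the result is the required preimage.  The
  gluing is continuous since the section is.  Conversely, forgetting a linkage turns a normal form
  into a normal form, and this is why the two maps are mutually inverse.
\<close>

section \<open>Rotations of the plane\<close>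

lemma rotation_matrix_mult:
  fixes A B :: "real^'n^'n"
  assumes "rotation_matrix A" "rotation_matrix B"
  shows "rotation_matrix (A ** B)"
  using assms by (simp add: rotation_matrix_def orthogonal_matrix_mul det_mul)

lemma rotation_matrix_transpose:
  fixes A :: "real^'n^'n"
  assumes "rotation_matrix A"
  shows "rotation_matrix (transpose A)"
  using assms by (simp add: rotation_matrix_def orthogonal_matrix_transpose det_transpose)

lemma matrix_vector_mult_2:
  fixes A :: "real^2^2"
  shows "(A *v v) $ 1 = A $ 1 $ 1 * v $ 1 + A $ 1 $ 2 * v $ 2"
    and "(A *v v) $ 2 = A $ 2 $ 1 * v $ 1 + A $ 2 $ 2 * v $ 2"
  by (simp_all add: matrix_vector_mult_def sum_2)

lemma rotation_matrix_preserving_positive_axis: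
  fixes A :: "real^2^2"
  assumes A: "rotation_matrix A"
    and v: "v $ 1 > 0" "v $ 2 = 0"
    and Av: "(A *v v) $ 1 > 0" "(A *v v) $ 2 = 0"
  shows "A = mat 1"
proof -
  have A21: "A $ 2 $ 1 = 0" and A11: "A $ 1 $ 1 > 0"
    using v Av by (auto simp: matrix_vector_mult_2 zero_less_mult_iff)
  have "transpose A ** A = mat 1" and det: "det A = 1"
    using A by (auto simp: rotation_matrix_def orthogonal_matrix)
  then have "(transpose A ** A) $ 1 $ 1 = 1" "(transpose A ** A) $ 1 $ 2 = 0"
    by (simp_all add: mat_def)
  then have "A $ 1 $ 1 * A $ 1 $ 1 = 1" "A $ 1 $ 1 * A $ 1 $ 2 = 0"
    using A21 by (simp_all add: matrix_matrix_mult_def transpose_def sum_2)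
  then have "A $ 1 $ 1 = 1" "A $ 1 $ 2 = 0"
    using A11 by (auto simp: square_eq_1_iff)
  moreover from this have "A $ 2 $ 2 = 1"
    using det A21 by (simp add: det_2)
  ultimately show ?thesis
    using A21 by (simp add: vec_eq_iff forall_2 mat_def)
qed

text \<open>This is the matrix with rows \<open>(u\<^sub>1, u\<^sub>2)\<close> and \<open>(-u\<^sub>2, u\<^sub>1)\<close>, scaled by \<open>1 / norm u\<close>: multiplication
  by the conjugate of the unit complex number \<open>u / norm u\<close>.\<close>

definition rotation_to_axis :: "real^2 \<Rightarrow> real^2^2" where
  "rotation_to_axis u =
     (\<chi> i j. (if i = 1 then u $ j else if j = 1 then - u $ 2 else u $ 1) / norm u)"

lemma norm_squared_2: "norm (u::real^2) * norm u = u $ 1 * u $ 1 + u $ 2 * u $ 2"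
  using power2_norm_eq_inner[of u] by (simp add: power2_eq_square inner_vec_def sum_2)

lemma rotation_matrix_rotation_to_axis:
  assumes "u \<noteq> 0"
  shows "rotation_matrix (rotation_to_axis u)"
proof -
  have nz: "u $ 1 * u $ 1 + u $ 2 * u $ 2 \<noteq> 0"
    using assms norm_squared_2[of u] by (metis mult_eq_0_iff norm_eq_zero)
  show ?thesis
    using nz
    by (simp add: rotation_matrix_def orthogonal_matrix det_2 vec_eq_iff forall_2
        matrix_matrix_mult_def transpose_def sum_2 mat_def rotation_to_axis_def
        norm_squared_2 flip: add_divide_distrib)
qed

lemma rotation_to_axis_self:
  assumes "u \<noteq> 0"
  shows "(rotation_to_axis u *v u) $ 1 > 0" "(rotation_to_axis u *v u) $ 2 = 0"
proof -
  have "u $ 1 * u $ 1 + u $ 2 * u $ 2 > 0"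
    using assms norm_squared_2[of u] by (metis zero_less_norm_iff mult_pos_pos)
  then show "(rotation_to_axis u *v u) $ 1 > 0" "(rotation_to_axis u *v u) $ 2 = 0"
    using assms by (simp_all add: matrix_vector_mult_2 rotation_to_axis_def
        flip: add_divide_distrib)
qed

lemma tendsto_rotation_to_axis:
  assumes "(f \<longlongrightarrow> u) F" "(g \<longlongrightarrow> v) F" "u \<noteq> 0"
  shows "((\<lambda>x. rotation_to_axis (f x) *v g x) \<longlongrightarrow> rotation_to_axis u *v v) F"
  unfolding matrix_vector_mult_def rotation_to_axis_def
  using assms by (auto intro!: tendsto_intros split: if_splits)

section \<open>Rotation orbits of joint configurations\<close>

lemma joint_configs_iff:
  "c \<in> joint_configs Fs \<longleftrightarrow>
     c \<in> extensional {..<length Fs} \<and>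
     (\<forall>j < length Fs. c j \<in> chain_configs (Fs ! j) \<and> c j 0 = 0 \<and>
        c j (length (Fs ! j)) = c 0 (length (Fs ! 0)))"
proof -
  have "(\<forall>j < n. \<forall>k < n. t j = t k) \<longleftrightarrow> (\<forall>j < n. t j = t 0)" for n and t :: "nat \<Rightarrow> real^2"
    by (metis gr_zeroI less_nat_zero_code)
  from this[of "length Fs" "\<lambda>j. c j (length (Fs ! j))"] show ?thesis
    unfolding joint_configs_def PiE_iff mem_Collect_eq lessThan_iff Ball_def by blast
qed

lemma joint_configs_extensional:
  assumes "c \<in> joint_configs Fs"
  shows "c \<in> extensional {..<length Fs}"
    and "j < length Fs \<Longrightarrow> c j \<in> extensional {0..length (Fs ! j)}"
  using assms by (auto simp: joint_configs_def chain_configs_def PiE_iff)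

lemma rotate_config_rotate_config:
  "rotate_config Fs A (rotate_config Fs B c) = rotate_config Fs (A ** B) c"
  by (auto simp: rotate_config_def fun_eq_iff restrict_def matrix_vector_mul_assoc)

lemma rotate_config_mat_1:
  assumes "c \<in> joint_configs Fs"
  shows "rotate_config Fs (mat 1) c = c"
  using joint_configs_extensional[OF assms]
  by (auto simp: rotate_config_def fun_eq_iff restrict_def extensional_def)

lemma mem_SO2_orbit_self:
  assumes "c \<in> joint_configs Fs"
  shows "c \<in> SO2_orbit Fs c"
proof -
  have "rotation_matrix (mat 1 :: real^2^2)"
    by (simp add: rotation_matrix_def orthogonal_matrix_id)
  then show ?thesis
    unfolding SO2_orbit_def using rotate_config_mat_1[OF assms] by force
qed

text \<open>The rotations form a group, so \<open>A\<close> can be undone and right translation by \<open>A\<close> permutes them.\<close>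

lemma SO2_orbit_rotate_config:
  assumes "rotation_matrix A" and "c \<in> joint_configs Fs"
  shows "SO2_orbit Fs (rotate_config Fs A c) = SO2_orbit Fs c"
proof
  show "SO2_orbit Fs (rotate_config Fs A c) \<subseteq> SO2_orbit Fs c"
    using assms by (auto simp: SO2_orbit_def rotate_config_rotate_config intro: rotation_matrix_mult)
next
  show "SO2_orbit Fs c \<subseteq> SO2_orbit Fs (rotate_config Fs A c)"
  proof
    fix e assume "e \<in> SO2_orbit Fs c"
    then obtain B where B: "rotation_matrix B" "e = rotate_config Fs B c"
      by (auto simp: SO2_orbit_def)
    have "B ** transpose A ** A = B"
      using assms by (simp add: rotation_matrix_def orthogonal_matrix flip: matrix_mul_assoc)
    then have "e = rotate_config Fs (B ** transpose A) (rotate_config Fs A c)"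
      using B by (simp add: rotate_config_rotate_config)
    then show "e \<in> SO2_orbit Fs (rotate_config Fs A c)"
      using B assms rotation_matrix_mult rotation_matrix_transpose by (auto simp: SO2_orbit_def)
  qed
qed

lemma SO2_orbit_subset:
  assumes "c \<in> joint_configs Fs"
  shows "SO2_orbit Fs c \<subseteq> joint_configs Fs"
  using assms by (auto simp: SO2_orbit_def rotate_config_in_joint_configs)

text \<open>The configuration space is a subspace of an iterated product over linkages and vertices, so
  continuity of a map into the configuration
  space is continuity of the motion of each vertex.\<close>

lemma continuous_map_into_config_space:
  "continuous_map X (config_space Fs) f \<longleftrightarrow>
     f \<in> topspace X \<rightarrow> joint_configs Fs \<and>
     (\<forall>j < length Fs. \<forall>i \<le> length (Fs ! j). continuous_map X euclidean (\<lambda>x. f x j i))"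
  (is "?L \<longleftrightarrow> ?R")
proof -
  have "f ` topspace X \<subseteq> extensional {..<length Fs}"
    "\<And>j. j < length Fs \<Longrightarrow> (\<lambda>x. f x j) ` topspace X \<subseteq> extensional {0..length (Fs ! j)}"
    if "f \<in> topspace X \<rightarrow> joint_configs Fs"
    using that joint_configs_extensional by blast+
  then show ?thesis
    unfolding config_space_def
    by (auto simp: continuous_map_in_subtopology continuous_map_componentwise Pi_iff)
qed

lemma continuous_map_vertex:
  assumes "j < length Fs" "i \<le> length (Fs ! j)"
  shows "continuous_map (config_space Fs) euclidean (\<lambda>c. c j i)"
  using continuous_map_into_config_space[of "config_space Fs" Fs "\<lambda>c. c"] assms by simp

lemma continuous_map_from_moduli_space:
  assumes "continuous_map (config_space Fs) Y (\<lambda>c. f (SO2_orbit Fs c))"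
  shows "continuous_map (moduli_space Fs) Y f"
  unfolding moduli_space_def
  by (rule continuous_compose_quotient_map[OF quotient_map_quotient_topology])
    (use assms in \<open>simp add: o_def\<close>)

lemma continuous_map_SO2_orbit:
  "continuous_map (config_space Fs) (moduli_space Fs) (SO2_orbit Fs)"
  unfolding moduli_space_def
  by (intro quotient_imp_continuous_map quotient_map_quotient_topology)

section \<open>The normal form of an orbit\<close>

definition on_axis :: "(nat \<Rightarrow> nat \<Rightarrow> real^2) \<Rightarrow> bool" where
  "on_axis c \<longleftrightarrow> c 0 (Suc 0) $ 1 > 0 \<and> c 0 (Suc 0) $ 2 = 0"

definition normal_form :: "(nat \<Rightarrow> nat \<Rightarrow> real^2) set \<Rightarrow> nat \<Rightarrow> nat \<Rightarrow> real^2" where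
  "normal_form P = (THE c. c \<in> P \<and> on_axis c)"

lemma first_edge_nonzero:
  assumes "c \<in> joint_configs (F # Fs)" and "free_linkage F"
  shows "c 0 (Suc 0) \<noteq> 0"
proof -
  have F: "0 < length F" "0 < F ! 0"
    using assms(2) by (auto simp: free_linkage_def)
  have "c 0 \<in> chain_configs F" "c 0 0 = 0"
    using assms(1) by (force simp: joint_configs_iff)+
  then have "dist 0 (c 0 (Suc 0)) = F ! 0"
    using F by (auto simp: chain_configs_def)
  then show ?thesis
    using F by auto
qed

text \<open>Freeness of the action: a rotation carrying one vector on the positive axis to another
  such vector is the identity.\<close>

lemma on_axis_unique:
  assumes c: "c \<in> joint_configs (F # Fs)" and F: "free_linkage F"
    and e: "e \<in> SO2_orbit (F # Fs) c"
    and ax: "on_axis c" "on_axis e"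
  shows "e = c"
proof -
  obtain A where A: "rotation_matrix A" "e = rotate_config (F # Fs) A c"
    using e by (auto simp: SO2_orbit_def)
  have "Suc 0 \<le> length F"
    using F by (cases F) (auto simp: free_linkage_def)
  then have "e 0 1 = A *v c 0 (Suc 0)"
    using A by (simp add: rotate_config_def)
  then have "A = mat 1"
    using A ax rotation_matrix_preserving_positive_axis[of A "c 0 (Suc 0)"] by (simp add: on_axis_def)
  then show ?thesis
    using A rotate_config_mat_1[OF c] by simp
qed

lemma normal_form_eqI:
  assumes c: "c \<in> joint_configs (F # Fs)" and F: "free_linkage F" and ax: "on_axis c"
  shows "normal_form (SO2_orbit (F # Fs) c) = c"
  unfolding normal_form_def
  by (rule the_equality) (use ax mem_SO2_orbit_self[OF c] on_axis_unique[OF c F] in blast)+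

lemma on_axis_rotate_config:
  assumes c: "c \<in> joint_configs (F # Fs)" and F: "free_linkage F"
  shows "on_axis (rotate_config (F # Fs) (rotation_to_axis (c 0 (Suc 0))) c)"
proof -
  have "Suc 0 \<le> length F"
    using F by (cases F) (auto simp: free_linkage_def)
  then show ?thesis
    using rotation_to_axis_self[OF first_edge_nonzero[OF c F]]
    by (simp add: on_axis_def rotate_config_def)
qed

lemma normal_form_SO2_orbit:
  assumes c: "c \<in> joint_configs (F # Fs)" and F: "free_linkage F"
  shows "normal_form (SO2_orbit (F # Fs) c) =
           rotate_config (F # Fs) (rotation_to_axis (c 0 (Suc 0))) c"
proof -
  have R: "rotation_matrix (rotation_to_axis (c 0 (Suc 0)))"
    using rotation_matrix_rotation_to_axis[OF first_edge_nonzero[OF c F]] .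
  show ?thesis
    using normal_form_eqI[OF rotate_config_in_joint_configs[OF R c] F on_axis_rotate_config[OF c F]]
    by (simp add: SO2_orbit_rotate_config[OF R c])
qed

lemma normal_form_moduli_space:
  assumes F: "free_linkage F" and P: "P \<in> topspace (moduli_space (F # Fs))"
  shows "normal_form P \<in> joint_configs (F # Fs)"
    and "on_axis (normal_form P)"
    and "SO2_orbit (F # Fs) (normal_form P) = P"
proof -
  obtain c where c: "c \<in> joint_configs (F # Fs)" "P = SO2_orbit (F # Fs) c"
    using P by (auto simp: moduli_space_def)
  have R: "rotation_matrix (rotation_to_axis (c 0 (Suc 0)))"
    using rotation_matrix_rotation_to_axis[OF first_edge_nonzero[OF c(1) F]] .
  show "normal_form P \<in> joint_configs (F # Fs)"
    "on_axis (normal_form P)"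
    "SO2_orbit (F # Fs) (normal_form P) = P"
    using c R F by (simp_all add: normal_form_SO2_orbit rotate_config_in_joint_configs
        on_axis_rotate_config SO2_orbit_rotate_config)
qed

text \<open>On configurations the normal form is a rotation whose entries are continuous functions of
  the first edge vector, which never vanishes; the universal property of the quotient transfers
  continuity to orbits.\<close>

lemma continuous_map_normal_form:
  assumes F: "free_linkage F"
  shows "continuous_map (moduli_space (F # Fs)) (config_space (F # Fs)) normal_form"
proof (rule continuous_map_from_moduli_space)
  let ?Fs = "F # Fs"
  let ?r = "\<lambda>c. rotate_config ?Fs (rotation_to_axis (c 0 (Suc 0))) c"
  have 1: "Suc 0 \<le> length F"
    using F by (cases F) (auto simp: free_linkage_def)
  have "continuous_map (config_space ?Fs) (config_space ?Fs) ?r"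
    unfolding continuous_map_into_config_space
  proof (intro conjI allI impI)
    show "?r \<in> topspace (config_space ?Fs) \<rightarrow> joint_configs ?Fs"
      using rotate_config_in_joint_configs rotation_matrix_rotation_to_axis
        first_edge_nonzero[OF _ F] by auto
  next
    fix j i assume ji: "j < length ?Fs" "i \<le> length (?Fs ! j)"
    have "((\<lambda>c. rotation_to_axis (c 0 (Suc 0)) *v c j i) \<longlongrightarrow> rotation_to_axis (c 0 (Suc 0)) *v c j i)
            (atin (config_space ?Fs) c)"
      if c: "c \<in> joint_configs ?Fs" for c
    proof (rule tendsto_rotation_to_axis)
      show "((\<lambda>c. c 0 (Suc 0)) \<longlongrightarrow> c 0 (Suc 0)) (atin (config_space ?Fs) c)"
        using continuous_map_vertex[of 0 ?Fs "Suc 0"] 1 c by (simp add: continuous_map_atin)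
      show "((\<lambda>c. c j i) \<longlongrightarrow> c j i) (atin (config_space ?Fs) c)"
        using continuous_map_vertex[OF ji] c by (simp add: continuous_map_atin)
      show "c 0 (Suc 0) \<noteq> 0"
        using first_edge_nonzero[OF c F] .
    qed
    then have "continuous_map (config_space ?Fs) euclidean (\<lambda>c. rotation_to_axis (c 0 (Suc 0)) *v c j i)"
      by (simp add: continuous_map_atin)
    then show "continuous_map (config_space ?Fs) euclidean (\<lambda>c. ?r c j i)"
      using ji by (simp add: rotate_config_def)
  qed
  then show "continuous_map (config_space ?Fs) (config_space ?Fs)
      (\<lambda>c. normal_form (SO2_orbit ?Fs c))"
    by (rule continuous_map_eq) (use F in \<open>simp add: normal_form_SO2_orbit\<close>)
qed

section \<open>Forgetting linkages\<close>

definition select_linkages :: "nat list \<Rightarrow> (nat \<Rightarrow> nat \<Rightarrow> real^2) \<Rightarrow> nat \<Rightarrow> nat \<Rightarrow> real^2" where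
  "select_linkages js c = (\<lambda>k\<in>{..<length js}. c (js ! k))"

text \<open>Reindexing the linkages covers both forgetful maps on \<open>M(F1, F2, F3)\<close> at once.\<close>

context
  fixes Fs :: "real list list" and js :: "nat list"
  assumes js: "set js \<subseteq> {..<length Fs}"
begin

lemma select_linkages_in_joint_configs:
  assumes c: "c \<in> joint_configs Fs"
  shows "select_linkages js c \<in> joint_configs (map ((!) Fs) js)"
proof -
  have "js ! k < length Fs" if "k < length js" for k
    using js that nth_mem by blast
  then show ?thesis
    using c unfolding joint_configs_def select_linkages_def by (auto simp: PiE_iff)
qed

lemma continuous_map_select_linkages:
  "continuous_map (config_space Fs) (config_space (map ((!) Fs) js)) (select_linkages js)"
proof -
  have "js ! k < length Fs" if "k < length js" for k
    using js that nth_mem by blast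
  then show ?thesis
    using select_linkages_in_joint_configs
    by (auto simp: continuous_map_into_config_space select_linkages_def continuous_map_vertex)
qed

lemma select_linkages_SO2_orbit:
  "select_linkages js ` SO2_orbit Fs c = SO2_orbit (map ((!) Fs) js) (select_linkages js c)"
proof -
  have "js ! k < length Fs" if "k < length js" for k
    using js that nth_mem by blast
  then have "select_linkages js (rotate_config Fs A c) =
      rotate_config (map ((!) Fs) js) A (select_linkages js c)" for A
    by (auto simp: select_linkages_def rotate_config_def fun_eq_iff restrict_def)
  then show ?thesis
    unfolding SO2_orbit_def by (auto simp: image_iff) metis+
qed

lemma continuous_map_select_linkages_moduli_space:
  "continuous_map (moduli_space Fs) (moduli_space (map ((!) Fs) js)) ((`) (select_linkages js))"
proof (rule continuous_map_from_moduli_space)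
  show "continuous_map (config_space Fs) (moduli_space (map ((!) Fs) js))
      (\<lambda>c. select_linkages js ` SO2_orbit Fs c)"
    using continuous_map_compose[OF continuous_map_select_linkages continuous_map_SO2_orbit]
    by (simp add: select_linkages_SO2_orbit o_def)
qed

end

section \<open>Gluing along the first linkage\<close>

definition glue :: "(nat \<Rightarrow> nat \<Rightarrow> real^2) \<Rightarrow> (nat \<Rightarrow> nat \<Rightarrow> real^2) \<Rightarrow> nat \<Rightarrow> nat \<Rightarrow> real^2" where
  "glue c e = (\<lambda>j\<in>{..<3}. if j < 2 then c j else e 1)"

lemma glue_in_joint_configs:
  assumes c: "c \<in> joint_configs [F1, F2]" and e: "e \<in> joint_configs [F1, F3]"
    and eq: "c 0 = e 0"
  shows "glue c e \<in> joint_configs [F1, F2, F3]"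
proof -
  have "c 0 \<in> chain_configs F1" "c 1 \<in> chain_configs F2" "e 1 \<in> chain_configs F3"
    "c 0 0 = 0" "c 1 0 = 0" "e 1 0 = 0"
    "c 0 (length F1) = c 1 (length F2)" "e 0 (length F1) = e 1 (length F3)"
    using c e by (simp_all add: joint_configs_iff All_less_Suc)
  then show ?thesis
    using eq by (simp add: joint_configs_iff All_less_Suc glue_def eval_nat_numeral)
qed

lemma select_linkages_glue:
  assumes "c \<in> joint_configs [F1, F2]" and "e \<in> joint_configs [F1, F3]" and "c 0 = e 0"
  shows "select_linkages [0, 1] (glue c e) = c" and "select_linkages [0, 2] (glue c e) = e"
proof -
  have ext: "c \<in> extensional {..<2}" "e \<in> extensional {..<2}"
    using assms(1,2)[THEN joint_configs_extensional(1)] by (simp_all add: eval_nat_numeral)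
  show "select_linkages [0, 1] (glue c e) = c"
    by (rule extensionalityI[OF _ ext(1)])
      (auto simp: select_linkages_def glue_def less_Suc_eq eval_nat_numeral)
  show "select_linkages [0, 2] (glue c e) = e"
    by (rule extensionalityI[OF _ ext(2)])
      (use assms(3) in \<open>auto simp: select_linkages_def glue_def less_Suc_eq eval_nat_numeral\<close>)
qed

lemma glue_select_linkages:
  assumes "c \<in> joint_configs [F1, F2, F3]"
  shows "glue (select_linkages [0, 1] c) (select_linkages [0, 2] c) = c"
proof -
  have ext: "c \<in> extensional {..<3}"
    using joint_configs_extensional(1)[OF assms] by (simp add: eval_nat_numeral)
  show ?thesis
    by (rule extensionalityI[OF _ ext])
      (auto simp: select_linkages_def glue_def less_Suc_eq eval_nat_numeral)
qed

text \<open>Restricting a normal form to the first linkage gives the normal form of the restricted orbit.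
  Hence the two normal forms induce the same configuration of \<open>F\<close>, which is what makes them
  compatible for gluing.\<close>

lemma normal_forms_agree_on_first:
  assumes F: "free_linkage F"
    and P: "P \<in> topspace (moduli_space (F # Fs))" and Q: "Q \<in> topspace (moduli_space (F # Gs))"
    and eq: "keep_first P = keep_first Q"
  shows "normal_form P 0 = normal_form Q 0"
proof -
  let ?c = "normal_form P" and ?e = "normal_form Q"
  note nP = normal_form_moduli_space[OF F P] and nQ = normal_form_moduli_space[OF F Q]
  have in1: "restrict ?c {..<1} \<in> joint_configs [F]" "restrict ?e {..<1} \<in> joint_configs [F]"
    using nP(1) nQ(1) by (force simp: joint_configs_iff)+
  have ax: "on_axis (restrict ?c {..<1})" "on_axis (restrict ?e {..<1})"
    using nP(2) nQ(2) by (auto simp: on_axis_def)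
  have "SO2_orbit [F] (restrict ?c {..<1}) = SO2_orbit [F] (restrict ?e {..<1})"
    using eq keep_first_SO2_orbit[of "F # Fs" ?c] keep_first_SO2_orbit[of "F # Gs" ?e] nP(3) nQ(3)
    by simp
  then have "restrict ?c {..<1} = restrict ?e {..<1}"
    using normal_form_eqI[OF in1(1) F ax(1)] normal_form_eqI[OF in1(2) F ax(2)] by simp
  then show ?thesis
    by (metis lessThan_iff restrict_apply' zero_less_one)
qed

text \<open>The map to the fibered product lands in the fibered product because both of its components
  retain the configuration of the first linkage.\<close>

lemma keep_first_select_linkages:
  "keep_first (select_linkages (0 # js) ` P) = keep_first (select_linkages (0 # ks) ` P)"
proof -
  have "restrict (select_linkages (0 # js) c) {..<1} = restrict (select_linkages (0 # ks) c) {..<1}"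
    for c
    by (auto simp: select_linkages_def fun_eq_iff restrict_def)
  then show ?thesis
    by (simp add: keep_first_def image_image)
qed

theorem theorem5p8:
  fixes F1 F2 F3 :: "real list"
  assumes "free_linkage F1" and "free_linkage F2" and "free_linkage F3"
  shows "moduli_space [F1, F2, F3] homeomorphic_space
         fibered_product (moduli_space [F1, F2]) keep_first (moduli_space [F1, F3]) keep_first"
proof -
  note F = assms(1)
  let ?M = "moduli_space [F1, F2, F3]"
  let ?Y = "fibered_product (moduli_space [F1, F2]) keep_first (moduli_space [F1, F3]) keep_first"
  define f where "f P = (select_linkages [0, 1] ` P, select_linkages [0, 2] ` P)"
    for P :: "(nat \<Rightarrow> nat \<Rightarrow> real^2) set"
  define h where "h = (\<lambda>(P, Q). glue (normal_form P) (normal_form Q))"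
  define g where "g = (\<lambda>y. SO2_orbit [F1, F2, F3] (h y))"
  have topY: "topspace ?Y = {(P, Q). P \<in> topspace (moduli_space [F1, F2]) \<and>
      Q \<in> topspace (moduli_space [F1, F3]) \<and> keep_first P = keep_first Q}"
    unfolding fibered_product_def topspace_subtopology topspace_prod_topology by blast
  have f: "continuous_map ?M ?Y f"
  proof -
    have "continuous_map ?M (moduli_space [F1, F2]) (\<lambda>P. select_linkages [0, 1] ` P)"
      using continuous_map_select_linkages_moduli_space[of "[0, 1]" "[F1, F2, F3]"] by simp
    moreover have "continuous_map ?M (moduli_space [F1, F3]) (\<lambda>P. select_linkages [0, 2] ` P)"
      using continuous_map_select_linkages_moduli_space[of "[0, 2]" "[F1, F2, F3]"] by simp
    ultimately have "continuous_map ?M (prod_topology (moduli_space [F1, F2]) (moduli_space [F1, F3])) f"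
      unfolding f_def by (simp add: continuous_map_paired)
    moreover have "keep_first (fst (f P)) = keep_first (snd (f P))" for P
      unfolding f_def fst_conv snd_conv by (rule keep_first_select_linkages)
    ultimately show ?thesis
      unfolding fibered_product_def by (simp add: continuous_map_in_subtopology case_prod_unfold Pi_iff)
  qed
  have agree: "normal_form P 0 = normal_form Q 0"
    and nP: "normal_form P \<in> joint_configs [F1, F2]" "SO2_orbit [F1, F2] (normal_form P) = P"
    and nQ: "normal_form Q \<in> joint_configs [F1, F3]" "SO2_orbit [F1, F3] (normal_form Q) = Q"
    if "(P, Q) \<in> topspace ?Y" for P Q
    using that normal_forms_agree_on_first[OF F] normal_form_moduli_space[OF F]
    by (auto simp: topY)
  have "continuous_map ?Y (config_space [F1, F2, F3]) h"
  proof -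
    have "continuous_map ?Y (moduli_space [F1, F2]) fst" "continuous_map ?Y (moduli_space [F1, F3]) snd"
      by (auto simp: fibered_product_def intro!: continuous_map_from_subtopology
          continuous_map_fst continuous_map_snd)
    then have "continuous_map ?Y (config_space [F1, F2]) (normal_form \<circ> fst)"
      "continuous_map ?Y (config_space [F1, F3]) (normal_form \<circ> snd)"
      using continuous_map_normal_form[OF F] continuous_map_compose by blast+
    moreover have "h y \<in> joint_configs [F1, F2, F3]" if "y \<in> topspace ?Y" for y
      using that glue_in_joint_configs agree nP nQ by (cases y) (auto simp: h_def)
    ultimately show ?thesis
      unfolding continuous_map_into_config_space
      by (auto simp: h_def glue_def case_prod_unfold less_Suc_eq numeral_3_eq_3)
  qed
  then have g: "continuous_map ?Y ?M g"
    using continuous_map_compose[OF _ continuous_map_SO2_orbit] by (fastforce simp: g_def o_def)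
  have "g (f P) = P" if "P \<in> topspace ?M" for P
  proof -
    let ?c = "normal_form P"
    note n = normal_form_moduli_space[OF F that]
    \<comment> \<open>Both restrictions of \<open>?c\<close> keep its first edge on the axis, so they are the normal forms of
      the orbits in \<open>f P\<close>, and gluing them restores \<open>?c\<close>.\<close>
    have c: "select_linkages [0, 1] ?c \<in> joint_configs [F1, F2]"
      "select_linkages [0, 2] ?c \<in> joint_configs [F1, F3]"
      using select_linkages_in_joint_configs[OF _ n(1), of "[0, 1]"]
        select_linkages_in_joint_configs[OF _ n(1), of "[0, 2]"] by simp_all
    have ax: "on_axis (select_linkages [0, 1] ?c)" "on_axis (select_linkages [0, 2] ?c)"
      using n(2) by (simp_all add: on_axis_def select_linkages_def)
    have "f P = (SO2_orbit [F1, F2] (select_linkages [0, 1] ?c),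
        SO2_orbit [F1, F3] (select_linkages [0, 2] ?c))"
      using select_linkages_SO2_orbit[of "[0, 1]" "[F1, F2, F3]" ?c]
        select_linkages_SO2_orbit[of "[0, 2]" "[F1, F2, F3]" ?c] n(3) by (simp add: f_def)
    then have "h (f P) = ?c"
      using c ax F glue_select_linkages[OF n(1)] by (simp add: h_def normal_form_eqI)
    then show ?thesis
      using n(3) by (simp add: g_def)
  qed
  moreover have "f (g (P, Q)) = (P, Q)" if "(P, Q) \<in> topspace ?Y" for P Q
    using select_linkages_SO2_orbit[of "[0, 1]" "[F1, F2, F3]" "h (P, Q)"]
      select_linkages_SO2_orbit[of "[0, 2]" "[F1, F2, F3]" "h (P, Q)"]
      select_linkages_glue[OF nP(1)[OF that] nQ(1)[OF that] agree[OF that]]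
      nP(2)[OF that] nQ(2)[OF that]
    by (simp add: f_def g_def h_def)
  ultimately have "homeomorphic_maps ?M ?Y f g"
    using f g by (auto simp: homeomorphic_maps_def)
  then show ?thesis
    unfolding homeomorphic_space_def by blast
qed

end
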